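(* Let $b\ge 2$ and $m\ge 1$ be integers and let $\mathcal{P}\subset[0,1]^2$ be a $(0,m,2)$-net in base $b$. Then $$\mathrm{disp}(\mathcal{P})\leq \frac{4b^2}{b^m}.$$
   Context: Dispersion: let $\mathcal{B}:=\{[x_1,y_1)\times[x_2,y_2)\mid 0\le x_1\le y_1\le 1,\ 0\le x_2\le y_2\le 1\}$. For a finite point set $\mathcal{P}\subset[0,1]^2$, $\mathrm{disp}(\mathcal{P}):=\sup_{B\in\mathcal{B},\,B\cap\mathcal{P}=\emptyset}\lambda(B)$, where $\lambda(B)$ is the area of $B$. A $(0,m,2)$-net in base $b$ is a point set in $[0,1]^2$ with $b^m$ elements such that every interval of the form $\left[\frac{a_1}{b^{j_1}},\frac{a_1+1}{b^{j_1}}\right)\times\left[\frac{a_2}{b^{j_2}},\frac{a_2+1}{b^{j_2}}\right)$ with integers $j_1,j_2\ge 0$, $j_1+j_2=m$, and $a_i\in\{0,1,\dots,b^{j_i}-1\}$ for $i\in\{1,2\}$, contains exactly one point of the point set. *)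

theory Defs
  imports "HOL-Analysis.Analysis"
begin

definition half_open_boxes :: "(real \<times> real) set set" where
  "half_open_boxes =
     {{x1..<y1} \<times> {x2..<y2} | x1 y1 x2 y2.
        0 \<le> x1 \<and> x1 \<le> y1 \<and> y1 \<le> 1 \<and> 0 \<le> x2 \<and> x2 \<le> y2 \<and> y2 \<le> 1}"

text \<open>The supremum of reals below is over a nonempty set (the empty box avoids every point)
  that is bounded above by 1, so it is a genuine least upper bound.\<close>

definition dispersion :: "(real \<times> real) set \<Rightarrow> real" where
  "dispersion P = (SUP B\<in>{B \<in> half_open_boxes. B \<inter> P = {}}. measure lborel B)"

definition elementary_interval ::
    "nat \<Rightarrow> nat \<Rightarrow> nat \<Rightarrow> nat \<Rightarrow> nat \<Rightarrow> (real \<times> real) set" where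
  "elementary_interval b j1 j2 a1 a2 =
     {real a1 / real b ^ j1 ..< (real a1 + 1) / real b ^ j1} \<times>
     {real a2 / real b ^ j2 ..< (real a2 + 1) / real b ^ j2}"

text \<open>\<open>net_0m2 b m P\<close>: the set \<open>P\<close> is a \<open>(0, m, 2)\<close>-net in base \<open>b\<close>.
  For \<open>b > 0\<close> the cardinality condition entails that \<open>P\<close> is finite.\<close>

definition net_0m2 :: "nat \<Rightarrow> nat \<Rightarrow> (real \<times> real) set \<Rightarrow> bool" where
  "net_0m2 b m P \<longleftrightarrow>
     P \<subseteq> {0..1} \<times> {0..1} \<and> card P = b ^ m \<and>
     (\<forall>j1 j2 a1 a2. j1 + j2 = m \<and> a1 < b ^ j1 \<and> a2 < b ^ j2 \<longrightarrow>
        (\<exists>!p. p \<in> P \<and> p \<in> elementary_interval b j1 j2 a1 a2))"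

end

theory Submission
  imports Defs
begin

text \<open>
  A box of width \<open>w\<close> and height \<open>h\<close> that avoids the net must be short or narrow at every scale:
  an interval of length at least \<open>2 / b ^ k\<close> contains a whole \<open>b\<close>-adic cell of length
  \<open>1 / b ^ k\<close>, so if \<open>w \<ge> 2 / b ^ k\<close> and \<open>h \<ge> 2 / b ^ (m - k)\<close> held for some \<open>k \<le> m\<close>, the box
  would contain an elementary interval of order \<open>m\<close>, and hence a point of the net
  (\<open>net_meets_large_box\<close>).  Take the largest \<open>k \<le> m\<close> with \<open>w < 2 / b ^ k\<close>.  Either \<open>k = m\<close>, and
  \<open>w\<close> alone is small enough, or \<open>w \<ge> 2 / b ^ (k + 1)\<close>, and then \<open>h < 2 / b ^ (m - k - 1)\<close>.  In
  both cases \<open>w * h \<le> 4 * b / b ^ m\<close>, which is a factor \<open>b\<close> better than the bound of the theorem.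
\<close>

text \<open>The witness is the first grid point \<open>a / N\<close> at or after \<open>x\<close>: it lies before \<open>x + 1 / N\<close>,
  so the cell that starts there ends before \<open>x + 2 / N\<close>.\<close>

lemma long_interval_contains_cell:
  fixes x y :: real and N :: nat
  assumes "N > 0" "0 \<le> x" "y \<le> 1" "2 / real N \<le> y - x"
  obtains a where "a < N" "{real a / real N ..< (real a + 1) / real N} \<subseteq> {x..<y}"
proof -
  define a where "a = nat \<lceil>x * real N\<rceil>"
  have N: "real N > 0" using assms(1) by simp
  have "0 \<le> x * real N" using assms(2) by simp
  then have a: "x * real N \<le> real a" "real a < x * real N + 1"
    unfolding a_def by linarith+
  have lo: "x \<le> real a / real N"
    using a(1) N by (simp add: field_simps)
  have "2 \<le> (y - x) * real N"
    using assms(4) N by (simp add: field_simps)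
  then have up: "real a + 1 \<le> y * real N"
    using a(2) by (simp add: algebra_simps)
  also have "\<dots> \<le> real N"
    using assms(3) N by simp
  finally have "a < N" by linarith
  moreover have "(real a + 1) / real N \<le> y"
    using up N by (simp add: field_simps)
  ultimately show thesis
    using lo by (intro that[of a]) auto
qed

lemma net_meets_large_box:
  assumes net: "net_0m2 b m P" and b: "b > 0" and k: "k \<le> m"
    and x: "0 \<le> x1" "y1 \<le> 1" "2 / real b ^ k \<le> y1 - x1"
    and y: "0 \<le> x2" "y2 \<le> 1" "2 / real b ^ (m - k) \<le> y2 - x2"
  shows "({x1..<y1} \<times> {x2..<y2}) \<inter> P \<noteq> {}"
proof -
  obtain a1 where a1: "a1 < b ^ k"
    "{real a1 / real (b ^ k) ..< (real a1 + 1) / real (b ^ k)} \<subseteq> {x1..<y1}"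
    using long_interval_contains_cell[of "b ^ k" x1 y1] b x by auto
  obtain a2 where a2: "a2 < b ^ (m - k)"
    "{real a2 / real (b ^ (m - k)) ..< (real a2 + 1) / real (b ^ (m - k))} \<subseteq> {x2..<y2}"
    using long_interval_contains_cell[of "b ^ (m - k)" x2 y2] b y by auto
  have "elementary_interval b k (m - k) a1 a2 \<subseteq> {x1..<y1} \<times> {x2..<y2}"
    unfolding elementary_interval_def using Sigma_mono[OF a1(2) a2(2)] by simp
  moreover obtain p where "p \<in> P" "p \<in> elementary_interval b k (m - k) a1 a2"
    using net k a1(1) a2(1) unfolding net_0m2_def by (metis le_add_diff_inverse)
  ultimately show ?thesis by blast
qed

lemma empty_box_area_le:
  assumes net: "net_0m2 b m P" and b: "b > 0"
    and x: "0 \<le> x1" "x1 \<le> y1" "y1 \<le> 1" and y: "0 \<le> x2" "x2 \<le> y2" "y2 \<le> 1"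
    and disj: "({x1..<y1} \<times> {x2..<y2}) \<inter> P = {}"
  shows "(y1 - x1) * (y2 - x2) \<le> 4 * real b / real b ^ m"
proof -
  let ?w = "y1 - x1" and ?h = "y2 - x2"
  let ?Q = "\<lambda>k. k \<le> m \<and> ?w < 2 / real b ^ k"
  define k where "k = (GREATEST k. ?Q k)"
  \<comment> \<open>The scale \<open>k = 0\<close> always qualifies, because \<open>?w \<le> 1 < 2\<close>.\<close>
  have "?Q 0" using x by simp
  then have k: "?Q k"
    unfolding k_def by (rule GreatestI_nat[where P = ?Q and b = m]) blast
  have max: "i \<le> k" if "?Q i" for i
    unfolding k_def using that by (rule Greatest_le_nat[where P = ?Q and b = m]) blast
  show ?thesis
  proof (cases "k = m")
    case True
    have "?w * ?h \<le> ?w * 1" using x y by (intro mult_left_mono) auto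
    also have "\<dots> \<le> 2 / real b ^ m" using k True by simp
    also have "\<dots> \<le> 4 * real b / real b ^ m"
      using b by (intro divide_right_mono) auto
    finally show ?thesis .
  next
    case False
    then have "Suc k \<le> m" using k by simp
    then have wide: "2 / real b ^ Suc k \<le> ?w"
      using max[of "Suc k"] by (meson not_less not_less_eq_eq order_refl)
    have short: "?h < 2 / real b ^ (m - Suc k)"
      using net_meets_large_box[OF net b \<open>Suc k \<le> m\<close> x(1,3) wide y(1,3)] disj by force
    have "?w * ?h \<le> (2 / real b ^ k) * (2 / real b ^ (m - Suc k))"
      using k short y by (intro mult_mono) auto
    also have "\<dots> = 4 / real b ^ (k + (m - Suc k))"
      by (simp add: power_add)
    also have "\<dots> = 4 * real b / real b ^ Suc (k + (m - Suc k))"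
      using b by simp
    also have "Suc (k + (m - Suc k)) = m" using \<open>Suc k \<le> m\<close> by simp
    finally show ?thesis .
  qed
qed

lemma measure_lborel_half_open_box:
  fixes x1 y1 x2 y2 :: real
  assumes "x1 \<le> y1" "x2 \<le> y2"
  shows "measure lborel ({x1..<y1} \<times> {x2..<y2}) = (y1 - x1) * (y2 - x2)"
  unfolding lborel_prod[symmetric] measure_def using assms
  by (simp add: lborel.emeasure_pair_measure_Times enn2real_mult)

theorem proposition2p1:
  fixes b m :: nat and P :: "(real \<times> real) set"
  assumes "b \<ge> 2" and "m \<ge> 1" and "net_0m2 b m P"
  shows "dispersion P \<le> 4 * real b ^ 2 / real b ^ m"
  unfolding dispersion_def
proof (rule cSUP_least)
  \<comment> \<open>A supremum over the empty set would be unspecified; the degenerate box avoids every point.\<close>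
  have "{0..<0} \<times> {0..<0} \<in> half_open_boxes"
    unfolding half_open_boxes_def by fastforce
  then show "{B \<in> half_open_boxes. B \<inter> P = {}} \<noteq> {}" by auto
next
  fix B assume "B \<in> {B \<in> half_open_boxes. B \<inter> P = {}}"
  then obtain x1 y1 x2 y2 where B: "B = {x1..<y1} \<times> {x2..<y2}" "B \<inter> P = {}"
    and x: "0 \<le> x1" "x1 \<le> y1" "y1 \<le> 1" and y: "0 \<le> x2" "x2 \<le> y2" "y2 \<le> 1"
    unfolding half_open_boxes_def by blast
  have "measure lborel B = (y1 - x1) * (y2 - x2)"
    using B(1) measure_lborel_half_open_box[OF x(2) y(2)] by simp
  also have "\<dots> \<le> 4 * real b / real b ^ m"
    using empty_box_area_le[OF assms(3) _ x y] assms(1) B by simp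
  also have "\<dots> \<le> 4 * real b ^ 2 / real b ^ m"
    using assms(1) by (intro divide_right_mono) (auto simp: power2_eq_square)
  finally show "measure lborel B \<le> 4 * real b ^ 2 / real b ^ m" .
qed

end
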